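(* Let $N\ge1$, let $W_0$ be an $N\times N$ nonnegative matrix without null rows and without null columns that has support, and let $(W_t)_t$ be the normalized sequence generated from $W_0$ by a sequence of normalizing operators $(T^{(k_t)}_{l_t})_{t\ge1}$, $k_t\in\{r,c\}$, $l_t\in\{1,\ldots,N\}$, such that for all $i,j\in\{1,\ldots,N\}$ one has $(k_t,l_t)=(r,i)$ for infinitely many $t$ and $(k_t,l_t)=(c,j)$ for infinitely many $t$. Then the sequence $(W_t)_t$ converges to a doubly stochastic matrix $W_\infty$ that depends only on the positive supported part $W_0^+$ of $W_0$ (that is, if two pairs of initial matrix and operator sequence are such that, in each pair, the initial matrix is an $N\times N$ nonnegative matrix without null rows and without null columns that has support, and the operator sequence $(T^{(k_t)}_{l_t})_{t\ge1}$, $k_t\in\{r,c\}$, $l_t\in\{1,\ldots,N\}$, satisfies for all $i,j\in\{1,\ldots,N\}$ that $(k_t,l_t)=(r,i)$ for infinitely many $t$ and $(k_t,l_t)=(c,j)$ for infinitely many $t$, and if the two initial matrices have the same positive supported part, then the two limits coincide).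
   Context: Normalizing operators, acting on $N\times N$ nonnegative matrices without null rows or columns: $T^{(r)}_{l}(W)$ is the matrix obtained from $W$ by dividing each entry of the $l$-th row by the $l$-th row sum $\sum_k W_{lk}$, leaving all other entries unchanged; $T^{(c)}_{l}(W)$ is obtained from $W$ by dividing each entry of the $l$-th column by the $l$-th column sum $\sum_k W_{kl}$, leaving all other entries unchanged. The normalized sequence generated by $(T^{(k_t)}_{l_t})_{t\ge1}$ from $W_0$ is defined inductively by $W_t=T^{(k_t)}_{l_t}(W_{t-1})$, $t\ge1$. A positive diagonal of $W$ is given by a permutation $\sigma$ of $\{1,\ldots,N\}$ with $\prod_{i=1}^N W_{i\sigma(i)}>0$; the position $(i_0,j_0)$ lies on it if $j_0=\sigma(i_0)$. $W$ has support if it has at least one positive diagonal. The positive supported part $W^+$ of $W$ is the matrix with $(W^+)_{ij}=W_{ij}$ if $(i,j)$ lies on some positive diagonal of $W$, and $(W^+)_{ij}=0$ otherwise. A doubly stochastic matrix is a nonnegative matrix whose rows and columns all sum to $1$. *)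

theory Defs
  imports "HOL-Analysis.Analysis"
begin

definition nonneg_matrix :: "real ^ 'n ^ 'n \<Rightarrow> bool" where
  "nonneg_matrix W \<longleftrightarrow> (\<forall>i j. 0 \<le> W $ i $ j)"

definition no_null_lines :: "real ^ 'n ^ 'n \<Rightarrow> bool" where
  "no_null_lines W \<longleftrightarrow> (\<forall>i. row i W \<noteq> 0) \<and> (\<forall>j. column j W \<noteq> 0)"

definition doubly_stochastic :: "real ^ 'n ^ 'n \<Rightarrow> bool" where
  "doubly_stochastic W \<longleftrightarrow>
     nonneg_matrix W \<and> (\<forall>i. (\<Sum>j\<in>UNIV. W $ i $ j) = 1) \<and> (\<forall>j. (\<Sum>i\<in>UNIV. W $ i $ j) = 1)"

definition positive_diagonal :: "real ^ 'n ^ 'n \<Rightarrow> ('n \<Rightarrow> 'n) \<Rightarrow> bool" where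
  "positive_diagonal W \<sigma> \<longleftrightarrow> \<sigma> permutes UNIV \<and> (\<Prod>i\<in>UNIV. W $ i $ \<sigma> i) > 0"

definition has_support :: "real ^ 'n ^ 'n \<Rightarrow> bool" where
  "has_support W \<longleftrightarrow> (\<exists>\<sigma>. positive_diagonal W \<sigma>)"

definition positive_supported_part :: "real ^ 'n ^ 'n \<Rightarrow> real ^ 'n ^ 'n" where
  "positive_supported_part W =
     (\<chi> i j. if \<exists>\<sigma>. positive_diagonal W \<sigma> \<and> j = \<sigma> i then W $ i $ j else 0)"

datatype line_kind = Row | Col

text \<open>
  Division is total, but on nonnegative matrices without null rows or columns (a class that is
  preserved by normalization) every divisor below is positive.
\<close>

fun normalize_line :: "line_kind \<times> 'n \<Rightarrow> real ^ 'n ^ 'n \<Rightarrow> real ^ 'n ^ 'n" where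
  "normalize_line (Row, l) W =
     (\<chi> i j. if i = l then W $ i $ j / (\<Sum>k\<in>UNIV. W $ l $ k) else W $ i $ j)"
| "normalize_line (Col, l) W =
     (\<chi> i j. if j = l then W $ i $ j / (\<Sum>k\<in>UNIV. W $ k $ l) else W $ i $ j)"

text \<open>Operator sequences are indexed from 1; the value at 0 is never used.\<close>

primrec normalized_seq ::
  "(nat \<Rightarrow> line_kind \<times> 'n) \<Rightarrow> real ^ 'n ^ 'n \<Rightarrow> nat \<Rightarrow> real ^ 'n ^ 'n" where
  "normalized_seq ops W 0 = W"
| "normalized_seq ops W (Suc t) = normalize_line (ops (Suc t)) (normalized_seq ops W t)"

definition every_line_infinitely_often :: "(nat \<Rightarrow> line_kind \<times> 'n) \<Rightarrow> bool" where
  "every_line_infinitely_often ops \<longleftrightarrow>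
     (\<forall>i j. infinite {t. t \<ge> 1 \<and> ops t = (Row, i)} \<and> infinite {t. t \<ge> 1 \<and> ops t = (Col, j)})"

end

theory Submission
  imports Defs
begin

text \<open>
  The proof measures progress by the unnormalized Kullback-Leibler divergence
  \<open>\<Sum> (B ln (B / W) - B + W)\<close> of a matrix \<open>W\<close> from a target \<open>B\<close> whose support is contained in
  that of \<open>W\<close>. If the target sums to 1 along a line, dividing that line of \<open>W\<close> by its sum \<open>s\<close>
  lowers the divergence by exactly \<open>s - 1 - ln s \<ge> 0\<close> (\<open>kl_div_normalize_line\<close>), whatever the
  other lines of \<open>W\<close> look like. This is why the order of the normalizations is irrelevant.

  With the permutation matrix of a positive diagonal as target, the monotonicity shows that the
  sequence is bounded, that the divisors tend to 1, and that the entries on positive diagonals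
  stay away from 0.

  Gaps between two normalizations of the same line may be arbitrarily long, so asymptotically
  small steps do not suffice. Let \<open>A\<close> be a cluster point, and suppose that some lines of \<open>A\<close> do
  not sum to 1. From a time at which the sequence is close to \<open>A\<close> until the next time at which
  such a line is normalized, only lines summing to 1 in \<open>A\<close> are treated, so the divergence from
  \<open>A\<close> does not increase and the sequence remains close to \<open>A\<close>. The next divisor is then far from
  1, infinitely often, which is impossible. So \<open>A\<close> is doubly stochastic, the divergence from
  \<open>A\<close> decreases for ever, and being small infinitely often it tends to 0
  (\<open>normalized_seq_converges\<close>).

  For uniqueness, the limit is positive exactly on the positive diagonals of the initial matrix:
  a positive entry of a doubly stochastic matrix lies on a positive diagonal
  (\<open>doubly_stochastic_entry_on_diagonal\<close>). On this common support, the logarithm of the ratio of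
  the limit \<open>A\<close> to the initial matrix is a limit of functions \<open>u\<^sub>i + v\<^sub>j\<close>, hence orthogonal to the
  difference of any two doubly stochastic matrices supported there. For two limits \<open>A\<close>, \<open>B\<close> this
  gives \<open>\<Sum> (A - B) (ln A - ln B) = 0\<close>, and monotonicity of the logarithm forces \<open>A = B\<close>.
\<close>

section \<open>Lines and line sums\<close>

abbreviation entry :: "real ^ 'n ^ 'n \<Rightarrow> 'n \<times> 'n \<Rightarrow> real" where
  "entry W p \<equiv> W $ fst p $ snd p"

text \<open>
  Rows and columns are both sets of positions, so that the divergence argument treats them
  alike.
\<close>

fun line_cells :: "line_kind \<times> 'n \<Rightarrow> ('n \<times> 'n) set" where
  "line_cells (Row, l) = {l} \<times> UNIV"
| "line_cells (Col, l) = UNIV \<times> {l}"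

definition line_sum :: "line_kind \<times> 'n \<Rightarrow> real ^ 'n ^ 'n \<Rightarrow> real" where
  "line_sum q W = (\<Sum>p\<in>line_cells q. entry W p)"

lemma line_sum_Row: "line_sum (Row, l) W = (\<Sum>k\<in>UNIV. W $ l $ k)"
proof -
  have "line_cells (Row, l) = Pair l ` UNIV"
    by auto
  then show ?thesis
    by (simp add: line_sum_def sum.reindex inj_on_def)
qed

lemma line_sum_Col: "line_sum (Col, l) W = (\<Sum>k\<in>UNIV. W $ k $ l)"
proof -
  have "line_cells (Col, l) = (\<lambda>k. (k, l)) ` UNIV"
    by auto
  then show ?thesis
    by (simp add: line_sum_def sum.reindex inj_on_def)
qed

lemma all_lines_iff: "(\<forall>q. P q) \<longleftrightarrow> (\<forall>l. P (Row, l)) \<and> (\<forall>l. P (Col, l))"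
  by (metis line_kind.exhaust surj_pair)

lemma doubly_stochastic_iff_line_sums:
  "doubly_stochastic W \<longleftrightarrow> nonneg_matrix W \<and> (\<forall>q. line_sum q W = 1)"
  unfolding all_lines_iff by (simp add: doubly_stochastic_def line_sum_Row line_sum_Col)

lemma doubly_stochastic_line_sum: "doubly_stochastic W \<Longrightarrow> line_sum q W = 1"
  unfolding doubly_stochastic_iff_line_sums by blast

lemma every_line_infinitely_often_iff:
  "every_line_infinitely_often ops \<longleftrightarrow> (\<forall>q. infinite {t. t \<ge> 1 \<and> ops t = q})"
  unfolding all_lines_iff every_line_infinitely_often_def by blast

lemma entry_normalize_line:
  "entry (normalize_line q W) p =
     (if p \<in> line_cells q then entry W p / line_sum q W else entry W p)"
  by (cases "(q, W)" rule: normalize_line.cases; cases p) (auto simp: line_sum_Row line_sum_Col)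

lemma finite_line_kind: "finite (UNIV :: line_kind set)"
proof -
  have "UNIV = {Row, Col}"
    using line_kind.exhaust by auto
  then show ?thesis
    by (metis finite.emptyI finite.insertI)
qed

lemma finite_lines: "finite (UNIV :: (line_kind \<times> 'n :: finite) set)"
  unfolding UNIV_Times_UNIV [symmetric] by (intro finite_cartesian_product finite_line_kind) simp

lemma line_sum_pos:
  fixes W :: "real ^ 'n ^ 'n"
  assumes "nonneg_matrix W" "no_null_lines W"
  shows "line_sum q W > 0"
proof -
  have "(\<exists>k. W $ l $ k \<noteq> 0) \<and> (\<exists>k. W $ k $ l \<noteq> 0)" for l
    using assms(2) by (auto simp: no_null_lines_def row_def column_def vec_eq_iff)
  then have "\<exists>p\<in>line_cells q. entry W p \<noteq> 0"
    by (cases q rule: line_cells.cases) auto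
  then obtain p where "p \<in> line_cells q" "entry W p > 0"
    using assms(1) by (force simp: nonneg_matrix_def less_le)
  then show ?thesis
    unfolding line_sum_def
    using assms(1) by (intro sum_pos2 [of _ p]) (auto simp: nonneg_matrix_def)
qed

section \<open>Normalized sequences rescale the initial matrix\<close>

text \<open>
  The factors are written as exponentials: they are positive, and their logarithms add up, which
  is what the orthogonality argument for uniqueness needs.
\<close>

definition rescaling :: "real ^ 'n ^ 'n \<Rightarrow> real ^ 'n ^ 'n \<Rightarrow> bool" where
  "rescaling W W' \<longleftrightarrow> (\<exists>u v. \<forall>i j. W' $ i $ j = exp (u i + v j) * W $ i $ j)"

lemma rescaling_refl: "rescaling W W"
  unfolding rescaling_def by (rule exI [of _ "\<lambda>_. 0"], rule exI [of _ "\<lambda>_. 0"]) simp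

lemma rescaling_trans:
  assumes "rescaling W W'" "rescaling W' W''"
  shows "rescaling W W''"
proof -
  obtain u v u' v' where "\<forall>i j. W' $ i $ j = exp (u i + v j) * W $ i $ j"
    and "\<forall>i j. W'' $ i $ j = exp (u' i + v' j) * W' $ i $ j"
    using assms unfolding rescaling_def by blast
  then have "\<forall>i j. W'' $ i $ j = exp ((u i + u' i) + (v j + v' j)) * W $ i $ j"
    by (simp add: exp_add)
  then show ?thesis
    unfolding rescaling_def by (intro exI [of _ "\<lambda>i. u i + u' i"] exI [of _ "\<lambda>j. v j + v' j"])
qed

lemma rescaling_normalize_line:
  fixes W :: "real ^ 'n ^ 'n"
  assumes "line_sum q W > 0"
  shows "rescaling W (normalize_line q W)"
proof (cases q rule: line_cells.cases)
  case (1 l)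
  let ?u = "\<lambda>i. if i = l then - ln (line_sum q W) else 0"
  have "\<forall>i j. normalize_line q W $ i $ j = exp (?u i + 0) * W $ i $ j"
    using assms by (auto simp: 1 line_sum_Row exp_minus divide_inverse)
  then show ?thesis
    unfolding rescaling_def by (intro exI [of _ ?u] exI [of _ "\<lambda>_. 0"])
next
  case (2 l)
  let ?v = "\<lambda>j. if j = l then - ln (line_sum q W) else 0"
  have "\<forall>i j. normalize_line q W $ i $ j = exp (0 + ?v j) * W $ i $ j"
    using assms by (auto simp: 2 line_sum_Col exp_minus divide_inverse)
  then show ?thesis
    unfolding rescaling_def by (intro exI [of _ "\<lambda>_. 0"] exI [of _ ?v])
qed

lemma rescaling_pos_iff:
  assumes "rescaling W W'"
  shows "0 < W' $ i $ j \<longleftrightarrow> 0 < W $ i $ j"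
  using assms unfolding rescaling_def by (auto simp: zero_less_mult_iff)

lemma rescaling_nonneg_matrix:
  assumes "rescaling W W'" "nonneg_matrix W"
  shows "nonneg_matrix W'"
  using assms unfolding rescaling_def nonneg_matrix_def by auto

lemma rescaling_no_null_lines:
  assumes "rescaling W W'" "no_null_lines W"
  shows "no_null_lines W'"
proof -
  have "W' $ i $ j = 0 \<longleftrightarrow> W $ i $ j = 0" for i j
    using assms(1) unfolding rescaling_def by auto
  then show ?thesis
    using assms(2) by (simp add: no_null_lines_def row_def column_def vec_eq_iff)
qed

lemma rescaling_normalized_seq:
  fixes W :: "real ^ 'n ^ 'n"
  assumes "nonneg_matrix W" "no_null_lines W"
  shows "rescaling W (normalized_seq ops W t)"
proof (induction t)
  case 0
  show ?case
    by (simp add: rescaling_refl)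
next
  case (Suc t)
  then have "line_sum (ops (Suc t)) (normalized_seq ops W t) > 0"
    by (intro line_sum_pos rescaling_nonneg_matrix [OF _ assms(1)]
        rescaling_no_null_lines [OF _ assms(2)])
  then show ?case
    using Suc by (auto intro: rescaling_trans rescaling_normalize_line)
qed

section \<open>Kullback-Leibler divergence\<close>

text \<open>
  The logarithm of the quotient is split into a difference, and \<open>ln 0 = 0\<close>; the formula has its
  usual meaning whenever \<open>b > 0\<close> or \<open>a = 0\<close>.
\<close>

definition kl_term :: "real \<Rightarrow> real \<Rightarrow> real" where
  "kl_term a b = a * (ln a - ln b) - a + b"

definition kl_div :: "real ^ 'n ^ 'n \<Rightarrow> real ^ 'n ^ 'n \<Rightarrow> real" where
  "kl_div B W = (\<Sum>p\<in>UNIV. kl_term (entry B p) (entry W p))"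

definition dominated :: "real ^ 'n ^ 'n \<Rightarrow> real ^ 'n ^ 'n \<Rightarrow> bool" where
  "dominated B W \<longleftrightarrow> nonneg_matrix B \<and> nonneg_matrix W \<and> (\<forall>i j. 0 < B $ i $ j \<longrightarrow> 0 < W $ i $ j)"

text \<open>
  The bound by the Hellinger distance follows from \<open>ln x \<le> x - 1\<close> at \<open>x = sqrt (b / a)\<close>. It gives
  nonnegativity and, at the same time, a quantitative form of the equality case.
\<close>

lemma hellinger_le_kl_term:
  assumes "0 \<le> a" "0 \<le> b" "0 < a \<Longrightarrow> 0 < b"
  shows "(sqrt a - sqrt b)\<^sup>2 \<le> kl_term a b"
proof (cases "a = 0")
  case True
  then show ?thesis
    using assms by (simp add: kl_term_def)
next
  case False
  then have pos: "0 < a" "0 < b"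
    using assms by auto
  have "ln (sqrt b / sqrt a) \<le> sqrt b / sqrt a - 1"
    using pos by (intro ln_le_minus_one) simp
  then have "(ln b - ln a) / 2 \<le> sqrt b / sqrt a - 1"
    using pos by (simp add: ln_div ln_sqrt diff_divide_distrib)
  then have "a * ((ln b - ln a) / 2) \<le> a * (sqrt b / sqrt a - 1)"
    using pos by (intro mult_left_mono) auto
  also have "\<dots> = sqrt a * sqrt b - a"
    using pos by (simp add: field_simps)
  finally have "a * (ln b - ln a) \<le> 2 * (sqrt a * sqrt b) - 2 * a"
    by simp
  then show ?thesis
    using pos by (simp add: kl_term_def power2_diff algebra_simps)
qed

lemma kl_term_nonneg:
  assumes "0 \<le> a" "0 \<le> b" "0 < a \<Longrightarrow> 0 < b"
  shows "0 \<le> kl_term a b"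
  using hellinger_le_kl_term [OF assms] by (meson order_trans zero_le_power2)

lemma kl_term_le_kl_div:
  fixes B W :: "real ^ 'n ^ 'n"
  assumes "dominated B W"
  shows "kl_term (entry B p) (entry W p) \<le> kl_div B W"
  unfolding kl_div_def using assms
  by (intro member_le_sum [of p UNIV "\<lambda>p. kl_term (entry B p) (entry W p)"])
    (auto simp: dominated_def nonneg_matrix_def intro: kl_term_nonneg)

lemma kl_div_nonneg:
  fixes B W :: "real ^ 'n ^ 'n"
  assumes "dominated B W"
  shows "0 \<le> kl_div B W"
  unfolding kl_div_def using assms
  by (intro sum_nonneg kl_term_nonneg) (auto simp: dominated_def nonneg_matrix_def)

lemma hellinger_le_kl_div:
  fixes B W :: "real ^ 'n ^ 'n"
  assumes "dominated B W"
  shows "(sqrt (entry B p) - sqrt (entry W p))\<^sup>2 \<le> kl_div B W"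
proof -
  have "(sqrt (entry B p) - sqrt (entry W p))\<^sup>2 \<le> kl_term (entry B p) (entry W p)"
    using assms by (intro hellinger_le_kl_term) (auto simp: dominated_def nonneg_matrix_def)
  also note kl_term_le_kl_div [OF assms]
  finally show ?thesis .
qed

text \<open>
  Only the entries of the line change, and the logarithms of the positive ones by \<open>- ln s\<close>; as the target has
  total mass 1 on the line, the terms with the logarithm contribute \<open>ln s\<close>, and the change of
  total mass contributes \<open>1 - s\<close>.
\<close>

lemma kl_div_normalize_line:
  fixes B W :: "real ^ 'n ^ 'n"
  assumes "dominated B W" "line_sum q B = 1" "line_sum q W > 0"
  shows "kl_div B (normalize_line q W) = kl_div B W - kl_term 1 (line_sum q W)"
proof -
  define s where "s = line_sum q W"
  have change: "kl_term (entry B p) (entry (normalize_line q W) p) - kl_term (entry B p) (entry W p)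
      = (if p \<in> line_cells q then entry B p * ln s + entry W p / s - entry W p else 0)" for p
  proof (cases "entry B p = 0")
    case True
    then show ?thesis
      unfolding entry_normalize_line by (simp add: kl_term_def s_def)
  next
    case False
    then have "entry W p > 0"
      using assms(1) by (auto simp: dominated_def nonneg_matrix_def less_le)
    then show ?thesis
      unfolding entry_normalize_line
      using assms(3) by (simp add: kl_term_def s_def ln_div algebra_simps)
  qed
  have "kl_div B (normalize_line q W) - kl_div B W
      = (\<Sum>p\<in>UNIV. if p \<in> line_cells q then entry B p * ln s + entry W p / s - entry W p else 0)"
    unfolding kl_div_def sum_subtractf [symmetric] change ..
  also have "\<dots> = (\<Sum>p\<in>line_cells q. entry B p * ln s + entry W p / s - entry W p)"
    by (subst sum.inter_restrict [symmetric]) auto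
  also have "\<dots> = line_sum q B * ln s + line_sum q W / s - line_sum q W"
    by (simp add: line_sum_def sum.distrib sum_subtractf sum_distrib_right sum_divide_distrib)
  also have "\<dots> = ln s + 1 - s"
    using assms(2,3) by (simp add: s_def)
  finally show ?thesis
    by (simp add: kl_term_def s_def)
qed

lemma tendsto_matrix_iff:
  fixes X :: "nat \<Rightarrow> real ^ 'n ^ 'n"
  shows "X \<longlonglongrightarrow> A \<longleftrightarrow> (\<forall>p. (\<lambda>t. entry (X t) p) \<longlonglongrightarrow> entry A p)"
proof
  assume "\<forall>p. (\<lambda>t. entry (X t) p) \<longlonglongrightarrow> entry A p"
  then have "\<forall>i j. (\<lambda>t. X t $ i $ j) \<longlonglongrightarrow> A $ i $ j"
    by simp
  then show "X \<longlonglongrightarrow> A"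
    by (intro vec_tendstoI) auto
qed (auto intro!: tendsto_vec_nth)

lemma kl_div_tendsto_0:
  fixes X :: "nat \<Rightarrow> real ^ 'n ^ 'n"
  assumes "X \<longlonglongrightarrow> A" "nonneg_matrix A"
  shows "(\<lambda>t. kl_div A (X t)) \<longlonglongrightarrow> 0"
proof -
  have "(\<lambda>t. kl_term (entry A p) (entry (X t) p)) \<longlonglongrightarrow> 0" for p
  proof -
    have lim: "(\<lambda>t. entry (X t) p) \<longlonglongrightarrow> entry A p"
      using assms(1) by (simp add: tendsto_matrix_iff)
    show ?thesis
    proof (cases "entry A p = 0")
      case True
      then show ?thesis
        using lim by (simp add: kl_term_def)
    next
      case False
      then have "(\<lambda>t. kl_term (entry A p) (entry (X t) p)) \<longlonglongrightarrow>
          entry A p * (ln (entry A p) - ln (entry A p)) - entry A p + entry A p"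
        unfolding kl_term_def by (intro tendsto_intros lim)
      then show ?thesis
        by simp
    qed
  qed
  then have "(\<lambda>t. kl_div A (X t)) \<longlonglongrightarrow> (\<Sum>p\<in>(UNIV :: ('n \<times> 'n) set). 0)"
    unfolding kl_div_def by (intro tendsto_sum)
  then show ?thesis
    by simp
qed

text \<open>
  Convergence is transferred through the square roots. The two uses are entries controlled by
  their divergence from a limit, and divisors controlled by the loss of divergence they cause.
\<close>

lemma tendsto_if_hellinger_tendsto_0:
  fixes b c :: "nat \<Rightarrow> real"
  assumes "c \<longlonglongrightarrow> 0" "\<And>t. (sqrt a - sqrt (b t))\<^sup>2 \<le> c t" "0 \<le> a" "\<And>t. 0 \<le> b t"
  shows "b \<longlonglongrightarrow> a"
proof -
  have "(\<lambda>t. (sqrt a - sqrt (b t))\<^sup>2) \<longlonglongrightarrow> 0"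
    by (rule tendsto_sandwich [OF _ _ tendsto_const assms(1)]) (auto simp: assms(2))
  then have "(\<lambda>t. sqrt a - sqrt (b t)) \<longlonglongrightarrow> 0"
    by simp
  then have "(\<lambda>t. sqrt a - (sqrt a - sqrt (b t))) \<longlonglongrightarrow> sqrt a - 0"
    by (intro tendsto_intros)
  then have "(\<lambda>t. (sqrt (b t))\<^sup>2) \<longlonglongrightarrow> (sqrt a)\<^sup>2"
    by (intro tendsto_power) simp
  then show ?thesis
    using assms(3,4) by simp
qed

lemma tendsto_if_kl_div_tendsto_0:
  fixes X :: "nat \<Rightarrow> real ^ 'n ^ 'n"
  assumes "(\<lambda>t. kl_div A (X t)) \<longlonglongrightarrow> 0" "\<And>t. dominated A (X t)"
  shows "X \<longlonglongrightarrow> A"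
  unfolding tendsto_matrix_iff
proof
  fix p
  show "(\<lambda>t. entry (X t) p) \<longlonglongrightarrow> entry A p"
    using hellinger_le_kl_div [OF assms(2)] assms(2)
    by (intro tendsto_if_hellinger_tendsto_0 [OF assms(1)])
      (auto simp: dominated_def nonneg_matrix_def)
qed

section \<open>Permutation matrices of positive diagonals\<close>

definition perm_matrix :: "('n \<Rightarrow> 'n) \<Rightarrow> real ^ 'n ^ 'n" where
  "perm_matrix \<sigma> = (\<chi> i j. if j = \<sigma> i then 1 else 0)"

lemma doubly_stochastic_perm_matrix:
  fixes \<sigma> :: "'n :: finite \<Rightarrow> 'n"
  assumes "\<sigma> permutes UNIV"
  shows "doubly_stochastic (perm_matrix \<sigma>)"
proof -
  have "(j = \<sigma> i) = (i = inv \<sigma> j)" for i j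
    using permutes_inv_eq [OF assms] by metis
  then have "(\<Sum>i\<in>UNIV. if j = \<sigma> i then 1 else 0) = (1 :: real)" for j
    by simp
  then show ?thesis
    by (simp add: doubly_stochastic_def nonneg_matrix_def perm_matrix_def)
qed

lemma positive_diagonal_iff:
  fixes W :: "real ^ 'n ^ 'n"
  assumes "nonneg_matrix W"
  shows "positive_diagonal W \<sigma> \<longleftrightarrow> \<sigma> permutes UNIV \<and> (\<forall>i. 0 < W $ i $ \<sigma> i)"
proof -
  have "0 < (\<Prod>i\<in>UNIV. W $ i $ \<sigma> i)" if "\<forall>i. 0 < W $ i $ \<sigma> i"
    using that by (intro prod_pos) auto
  moreover have "0 < W $ i $ \<sigma> i" if "0 < (\<Prod>i\<in>UNIV. W $ i $ \<sigma> i)" for i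
  proof -
    have "W $ i $ \<sigma> i \<noteq> 0"
      using that by (metis UNIV_I finite_class.finite_UNIV less_irrefl prod_zero)
    then show ?thesis
      using assms by (simp add: nonneg_matrix_def less_le)
  qed
  ultimately show ?thesis
    by (auto simp: positive_diagonal_def)
qed

section \<open>Convergence to a doubly stochastic matrix\<close>

locale normalization =
  fixes W :: "real ^ 'n ^ 'n" and ops :: "nat \<Rightarrow> line_kind \<times> 'n"
  assumes nonneg: "nonneg_matrix W" and no_null: "no_null_lines W" and support: "has_support W"
    and all_lines: "every_line_infinitely_often ops"
begin

abbreviation X :: "nat \<Rightarrow> real ^ 'n ^ 'n" where
  "X \<equiv> normalized_seq ops W"

definition divisor :: "nat \<Rightarrow> real" where
  "divisor t = line_sum (ops (Suc t)) (X t)"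

lemma rescaling_X: "rescaling W (X t)"
  using nonneg no_null by (rule rescaling_normalized_seq)

lemma nonneg_X: "nonneg_matrix (X t)"
  using rescaling_X nonneg by (rule rescaling_nonneg_matrix)

lemma dominated_X: "dominated B W \<Longrightarrow> dominated B (X t)"
  using rescaling_pos_iff [OF rescaling_X [of t]] nonneg_X [of t] by (simp add: dominated_def)

lemma divisor_pos: "0 < divisor t"
  unfolding divisor_def
  by (intro line_sum_pos nonneg_X rescaling_no_null_lines [OF rescaling_X no_null])

lemma kl_div_Suc:
  assumes "dominated B W" "line_sum (ops (Suc t)) B = 1"
  shows "kl_div B (X (Suc t)) = kl_div B (X t) - kl_term 1 (divisor t)"
  using kl_div_normalize_line [OF dominated_X [OF assms(1)] assms(2)] divisor_pos
  by (simp add: divisor_def)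

lemma kl_div_antimono:
  assumes "dominated B W" "m \<le> n" "\<And>t. m \<le> t \<Longrightarrow> t < n \<Longrightarrow> line_sum (ops (Suc t)) B = 1"
  shows "kl_div B (X n) \<le> kl_div B (X m)"
  using assms(2,3)
proof (induction n rule: dec_induct)
  case (step n)
  have "0 \<le> kl_term 1 (divisor n)"
    using divisor_pos [of n] by (intro kl_term_nonneg) auto
  moreover have "kl_div B (X (Suc n)) = kl_div B (X n) - kl_term 1 (divisor n)"
    using assms(1) step by (intro kl_div_Suc) auto
  moreover have "kl_div B (X n) \<le> kl_div B (X m)"
    using step.prems by (intro step.IH) auto
  ultimately show ?case
    by linarith
qed simp

lemma kl_div_decseq:
  assumes "dominated B W" "doubly_stochastic B"
  shows "decseq (\<lambda>t. kl_div B (X t))"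
  unfolding decseq_def
  using kl_div_antimono [OF assms(1)] doubly_stochastic_line_sum [OF assms(2)] by blast

lemma dominated_perm_matrix:
  assumes "positive_diagonal W \<sigma>"
  shows "dominated (perm_matrix \<sigma>) W"
  using assms nonneg
  by (auto simp: positive_diagonal_iff dominated_def perm_matrix_def nonneg_matrix_def
      split: if_splits)

lemma kl_div_perm_matrix_le:
  assumes "positive_diagonal W \<sigma>"
  shows "kl_div (perm_matrix \<sigma>) (X t) \<le> kl_div (perm_matrix \<sigma>) W"
  using decseqD [OF kl_div_decseq [OF dominated_perm_matrix [OF assms]], of 0 t] assms
  by (simp add: doubly_stochastic_perm_matrix positive_diagonal_def)

lemma bounded_X: "bounded (range X)"
proof -
  obtain \<sigma> where \<sigma>: "positive_diagonal W \<sigma>"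
    using support by (auto simp: has_support_def)
  define P where "P = perm_matrix \<sigma>"
  define C where "C = kl_div P W"
  have dom: "dominated P (X t)" for t
    unfolding P_def by (intro dominated_X dominated_perm_matrix \<sigma>)
  have "0 \<le> C"
    unfolding C_def P_def by (intro kl_div_nonneg dominated_perm_matrix \<sigma>)
  \<comment> \<open>The square root of an entry of \<open>P\<close> is at most 1, and that of the corresponding entry of \<open>X t\<close>
    is within \<open>sqrt C\<close> of it.\<close>
  have "entry (X t) p \<le> (1 + sqrt C)\<^sup>2" for t p
  proof -
    have "(sqrt (entry P p) - sqrt (entry (X t) p))\<^sup>2 \<le> C"
      using hellinger_le_kl_div [OF dom] kl_div_perm_matrix_le [OF \<sigma>]
      unfolding P_def C_def by (rule order_trans)
    then have "\<bar>sqrt (entry P p) - sqrt (entry (X t) p)\<bar> \<le> sqrt C"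
      by (metis real_sqrt_abs real_sqrt_le_mono)
    moreover have "sqrt (entry P p) \<le> 1"
      by (simp add: P_def perm_matrix_def)
    ultimately have "sqrt (entry (X t) p) \<le> 1 + sqrt C"
      by linarith
    then show ?thesis
      by (rule sqrt_le_D)
  qed
  then have "X t \<in> {0 .. (\<chi> i j. (1 + sqrt C)\<^sup>2)}" for t
    using nonneg_X [of t] by (auto simp: less_eq_vec_def nonneg_matrix_def)
  then have "range X \<subseteq> {0 .. (\<chi> i j. (1 + sqrt C)\<^sup>2)}"
    by blast
  with bounded_closed_interval show ?thesis
    by (rule bounded_subset)
qed

lemma divisor_tendsto_1: "divisor \<longlonglongrightarrow> 1"
proof -
  obtain \<sigma> where \<sigma>: "positive_diagonal W \<sigma>"
    using support by (auto simp: has_support_def)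
  let ?P = "perm_matrix \<sigma>"
  have dom: "dominated ?P W" and ds: "doubly_stochastic ?P"
    using \<sigma> by (auto intro: dominated_perm_matrix doubly_stochastic_perm_matrix
        simp: positive_diagonal_def)
  have "\<forall>t. 0 \<le> kl_div ?P (X t)"
    using kl_div_nonneg [OF dominated_X [OF dom]] by blast
  then obtain L where L: "(\<lambda>t. kl_div ?P (X t)) \<longlonglongrightarrow> L"
    using decseq_convergent [OF kl_div_decseq [OF dom ds]] by blast
  have "(\<lambda>t. kl_div ?P (X t) - kl_div ?P (X (Suc t))) \<longlonglongrightarrow> L - L"
    by (intro tendsto_diff L LIMSEQ_Suc [OF L])
  then have "(\<lambda>t. kl_term 1 (divisor t)) \<longlonglongrightarrow> 0"
    by (simp only: kl_div_Suc [OF dom doubly_stochastic_line_sum [OF ds]]) simp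
  moreover have "(sqrt 1 - sqrt (divisor t))\<^sup>2 \<le> kl_term 1 (divisor t)" for t
    using divisor_pos [of t] by (intro hellinger_le_kl_term) auto
  ultimately show ?thesis
    by (rule tendsto_if_hellinger_tendsto_0) (use divisor_pos in \<open>auto intro: less_imp_le\<close>)
qed

lemma line_infinitely_often: "\<exists>n\<ge>m. ops (Suc n) = q"
proof -
  have "infinite {t. t \<ge> 1 \<and> ops t = q}"
    using all_lines unfolding every_line_infinitely_often_iff by blast
  then obtain t where "t \<ge> Suc m" "ops t = q"
    by (metis (mono_tags, lifting) infinite_nat_iff_unbounded_le mem_Collect_eq)
  then show ?thesis
    by (metis Suc_le_D Suc_le_mono)
qed

lemma dominated_cluster_point:
  assumes "(\<lambda>k. X (r k)) \<longlonglongrightarrow> A"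
  shows "dominated A W"
proof -
  have lim: "(\<lambda>k. X (r k) $ i $ j) \<longlonglongrightarrow> A $ i $ j" for i j
    using assms by (intro tendsto_vec_nth)
  have "0 \<le> A $ i $ j" for i j
    using nonneg_X by (intro LIMSEQ_le_const [OF lim]) (auto simp: nonneg_matrix_def)
  moreover have "0 < W $ i $ j" if pos: "0 < A $ i $ j" for i j
  proof -
    obtain k where "0 < X (r k) $ i $ j"
      using order_tendstoD(1) [OF lim [of i j] pos] by (auto simp: eventually_sequentially)
    then show ?thesis
      using rescaling_pos_iff [OF rescaling_X] by blast
  qed
  ultimately show ?thesis
    using nonneg by (simp add: dominated_def nonneg_matrix_def)
qed

lemma doubly_stochastic_cluster_point:
  assumes "strict_mono r" and lim: "(\<lambda>k. X (r k)) \<longlonglongrightarrow> A"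
  shows "doubly_stochastic A"
proof (rule ccontr)
  assume "\<not> doubly_stochastic A"
  have dom: "dominated A W"
    using lim by (rule dominated_cluster_point)
  then have nonneg_A: "nonneg_matrix A"
    by (simp add: dominated_def)
  define bad where "bad = {q. line_sum q A \<noteq> 1}"
  obtain q0 where "q0 \<in> bad"
    using \<open>\<not> doubly_stochastic A\<close> nonneg_A unfolding doubly_stochastic_iff_line_sums bad_def by blast
  have "finite bad"
    using finite_lines by (rule rev_finite_subset) simp
  define \<delta> where "\<delta> = Min ((\<lambda>q. \<bar>line_sum q A - 1\<bar>) ` bad)"
  have \<delta>_le: "\<delta> \<le> \<bar>line_sum q A - 1\<bar>" if "q \<in> bad" for q
    unfolding \<delta>_def using \<open>finite bad\<close> that by (intro Min_le) auto
  have "0 < \<delta>"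
    unfolding \<delta>_def using \<open>finite bad\<close> \<open>q0 \<in> bad\<close> by (subst Min_gr_iff) (blast, blast, simp add: bad_def)
  \<comment> \<open>The first time from \<open>r k\<close> on at which a line that does not sum to 1 in \<open>A\<close> is about to be
    normalized.\<close>
  define n where "n k = (LEAST t. r k \<le> t \<and> ops (Suc t) \<in> bad)" for k
  have n: "r k \<le> n k \<and> ops (Suc (n k)) \<in> bad" for k
    unfolding n_def by (rule LeastI_ex) (metis \<open>q0 \<in> bad\<close> line_infinitely_often)
  have good: "line_sum (ops (Suc t)) A = 1" if "r k \<le> t" "t < n k" for k t
    using not_less_Least [of t "\<lambda>t. r k \<le> t \<and> ops (Suc t) \<in> bad"] that
    by (auto simp: n_def bad_def)
  have upper: "kl_div A (X (n k)) \<le> kl_div A (X (r k))" for k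
    using n good by (intro kl_div_antimono dom) auto
  have lower: "0 \<le> kl_div A (X (n k))" for k
    by (intro kl_div_nonneg dominated_X dom)
  have "(\<lambda>k. kl_div A (X (r k))) \<longlonglongrightarrow> 0"
    using lim nonneg_A by (rule kl_div_tendsto_0)
  then have "(\<lambda>k. kl_div A (X (n k))) \<longlonglongrightarrow> 0"
    by (rule tendsto_sandwich [OF _ _ tendsto_const, rotated 2]) (simp_all add: upper lower)
  then have "(\<lambda>k. X (n k)) \<longlonglongrightarrow> A"
    by (intro tendsto_if_kl_div_tendsto_0 dominated_X dom)
  then have "(\<lambda>k. line_sum q (X (n k))) \<longlonglongrightarrow> line_sum q A" for q
    unfolding line_sum_def by (intro tendsto_sum) (simp add: tendsto_matrix_iff)
  then have "\<forall>\<^sub>F k in sequentially. dist (line_sum q (X (n k))) (line_sum q A) < \<delta> / 2" for q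
    by (rule tendstoD) (use \<open>0 < \<delta>\<close> in simp)
  then have "\<forall>\<^sub>F k in sequentially. \<forall>q\<in>UNIV. dist (line_sum q (X (n k))) (line_sum q A) < \<delta> / 2"
    by (intro eventually_ball_finite finite_lines ballI)
  moreover have "filterlim n at_top sequentially"
  proof (rule filterlim_at_top_mono)
    show "filterlim r at_top sequentially"
      using assms(1) by (rule filterlim_subseq)
  qed (simp add: n)
  then have "(\<lambda>k. divisor (n k)) \<longlonglongrightarrow> 1"
    by (rule filterlim_compose [OF divisor_tendsto_1])
  then have "\<forall>\<^sub>F k in sequentially. dist (divisor (n k)) 1 < \<delta> / 2"
    by (rule tendstoD) (use \<open>0 < \<delta>\<close> in simp)
  ultimately have "\<forall>\<^sub>F k in sequentially. False"
  proof eventually_elim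
    case (elim k)
    then have "dist (divisor (n k)) (line_sum (ops (Suc (n k))) A) < \<delta> / 2"
      unfolding divisor_def by blast
    moreover have "\<delta> \<le> \<bar>line_sum (ops (Suc (n k))) A - 1\<bar>"
      using n by (intro \<delta>_le) blast
    ultimately show False
      using elim(2) unfolding dist_real_def by linarith
  qed
  then show False
    by simp
qed

theorem normalized_seq_converges:
  "\<exists>A. doubly_stochastic A \<and> X \<longlonglongrightarrow> A"
proof -
  obtain A r where r: "strict_mono r" and "(X \<circ> r) \<longlonglongrightarrow> A"
    using bounded_imp_convergent_subsequence [OF bounded_X] by blast
  then have lim: "(\<lambda>k. X (r k)) \<longlonglongrightarrow> A"
    by (simp add: o_def)
  have dom: "dominated A W"
    using lim by (rule dominated_cluster_point)
  have ds: "doubly_stochastic A"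
    using r lim by (rule doubly_stochastic_cluster_point)
  have "\<forall>t. 0 \<le> kl_div A (X t)"
    using kl_div_nonneg [OF dominated_X [OF dom]] by blast
  then obtain L where L: "(\<lambda>t. kl_div A (X t)) \<longlonglongrightarrow> L"
    using decseq_convergent [OF kl_div_decseq [OF dom ds]] by blast
  have "(\<lambda>k. kl_div A (X (r k))) \<longlonglongrightarrow> L"
    using LIMSEQ_subseq_LIMSEQ [OF L r] by (simp add: o_def)
  moreover have "(\<lambda>k. kl_div A (X (r k))) \<longlonglongrightarrow> 0"
    using lim dom by (intro kl_div_tendsto_0) (auto simp: dominated_def)
  ultimately have "L = 0"
    by (rule LIMSEQ_unique)
  then have "X \<longlonglongrightarrow> A"
    using L by (intro tendsto_if_kl_div_tendsto_0 dominated_X dom) simp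
  with ds show ?thesis
    by blast
qed

text \<open>
  The divergence from the permutation matrix of the diagonal bounds \<open>- ln\<close> of each entry on the
  diagonal from above, uniformly in time.
\<close>

lemma limit_pos_on_diagonal:
  assumes "X \<longlonglongrightarrow> A" and \<sigma>: "positive_diagonal W \<sigma>"
  shows "0 < A $ i $ \<sigma> i"
proof -
  define C where "C = kl_div (perm_matrix \<sigma>) W"
  have "exp (- 1 - C) \<le> X t $ i $ \<sigma> i" for t
  proof -
    have "kl_term (entry (perm_matrix \<sigma>) (i, \<sigma> i)) (entry (X t) (i, \<sigma> i)) \<le> C"
      using kl_term_le_kl_div [OF dominated_X [OF dominated_perm_matrix [OF \<sigma>]]]
        kl_div_perm_matrix_le [OF \<sigma>] unfolding C_def by (rule order_trans)
    then have "- ln (X t $ i $ \<sigma> i) - 1 + X t $ i $ \<sigma> i \<le> C"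
      by (simp add: kl_term_def perm_matrix_def)
    moreover have "0 < X t $ i $ \<sigma> i"
      using \<sigma> rescaling_pos_iff [OF rescaling_X] nonneg by (auto simp: positive_diagonal_iff)
    ultimately show ?thesis
      by (subst ln_ge_iff [symmetric]) auto
  qed
  moreover have "(\<lambda>t. X t $ i $ \<sigma> i) \<longlonglongrightarrow> A $ i $ \<sigma> i"
    using assms(1) by (intro tendsto_vec_nth)
  ultimately have "exp (- 1 - C) \<le> A $ i $ \<sigma> i"
    by (intro LIMSEQ_le_const) auto
  then show ?thesis
    by (meson exp_gt_zero less_le_trans)
qed

text \<open>
  On the support of the limit \<open>A\<close>, \<open>ln A - ln W\<close> is a limit of functions \<open>u\<^sub>i + v\<^sub>j\<close>, and a matrix
  with vanishing line sums is orthogonal to these.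
\<close>

lemma limit_orthogonality:
  fixes H :: "real ^ 'n ^ 'n"
  assumes lim: "X \<longlonglongrightarrow> A"
    and H_lines: "\<And>q. line_sum q H = 0" and H_supp: "\<And>i j. \<not> 0 < A $ i $ j \<Longrightarrow> H $ i $ j = 0"
  shows "(\<Sum>p\<in>UNIV. entry H p * (ln (entry A p) - ln (entry W p))) = 0"
proof -
  have dom: "dominated A W"
    using dominated_cluster_point [of "\<lambda>t. t"] lim by simp
  have zero: "(\<Sum>p\<in>UNIV. entry H p * (ln (entry (X t) p) - ln (entry W p))) = 0" for t
  proof -
    obtain u v where uv: "\<And>i j. X t $ i $ j = exp (u i + v j) * W $ i $ j"
      using rescaling_X [of t] unfolding rescaling_def by blast
    have "entry H p * (ln (entry (X t) p) - ln (entry W p)) = entry H p * (u (fst p) + v (snd p))"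
      for p
    proof (cases "0 < entry A p")
      case True
      then have "0 < entry W p"
        using dom by (simp add: dominated_def)
      then show ?thesis
        by (simp add: uv ln_mult_pos)
    qed (simp add: H_supp)
    then have "(\<Sum>p\<in>UNIV. entry H p * (ln (entry (X t) p) - ln (entry W p)))
        = (\<Sum>p\<in>UNIV. entry H p * (u (fst p) + v (snd p)))"
      by (intro sum.cong refl)
    also have "\<dots> = (\<Sum>i\<in>UNIV. \<Sum>j\<in>UNIV. H $ i $ j * (u i + v j))"
      by (simp add: sum.cartesian_product case_prod_beta)
    also have "\<dots> = (\<Sum>i\<in>UNIV. \<Sum>j\<in>UNIV. H $ i $ j * u i) + (\<Sum>i\<in>UNIV. \<Sum>j\<in>UNIV. H $ i $ j * v j)"
      by (simp add: distrib_left sum.distrib)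
    also have "(\<Sum>i\<in>UNIV. \<Sum>j\<in>UNIV. H $ i $ j * v j) = (\<Sum>j\<in>UNIV. \<Sum>i\<in>UNIV. H $ i $ j * v j)"
      by (rule sum.swap)
    also have "(\<Sum>i\<in>UNIV. \<Sum>j\<in>UNIV. H $ i $ j * u i) + \<dots>
        = (\<Sum>i\<in>UNIV. line_sum (Row, i) H * u i) + (\<Sum>j\<in>UNIV. line_sum (Col, j) H * v j)"
      by (simp add: line_sum_Row line_sum_Col sum_distrib_right)
    finally show ?thesis
      by (simp add: H_lines)
  qed
  have "(\<lambda>t. entry H p * (ln (entry (X t) p) - ln (entry W p)))
      \<longlonglongrightarrow> entry H p * (ln (entry A p) - ln (entry W p))" for p
  proof (cases "0 < entry A p")
    case True
    have "(\<lambda>t. entry (X t) p) \<longlonglongrightarrow> entry A p"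
      using lim by (simp add: tendsto_matrix_iff)
    then show ?thesis
      using True by (intro tendsto_mult tendsto_diff tendsto_ln tendsto_const) auto
  qed (simp add: H_supp)
  then have "(\<lambda>t. \<Sum>p\<in>UNIV. entry H p * (ln (entry (X t) p) - ln (entry W p)))
      \<longlonglongrightarrow> (\<Sum>p\<in>UNIV. entry H p * (ln (entry A p) - ln (entry W p)))"
    by (intro tendsto_sum)
  then show ?thesis
    by (simp add: zero LIMSEQ_const_iff)
qed

end

section \<open>Positive entries of doubly stochastic matrices\<close>

text \<open>
  A simple path, listed backwards, is closed up to a cycle that sends its end \<open>hd xs\<close> to its
  start \<open>last xs\<close>. The cycle is built edge by edge by composition with transpositions.
\<close>

lemma path_closing_permutation:
  assumes "xs \<noteq> []" "distinct xs" "successively (\<lambda>w v. E v w) xs"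
  shows "\<exists>\<pi>. \<pi> permutes set xs \<and> \<pi> (hd xs) = last xs \<and> (\<forall>x\<in>set xs - {hd xs}. E x (\<pi> x))"
  using assms
proof (induction xs rule: induct_list012)
  case (2 x)
  show ?case
    by (intro exI [of _ id] conjI permutes_id) auto
next
  case (3 w v zs)
  then obtain \<pi> where \<pi>: "\<pi> permutes set (v # zs)" "\<pi> v = last (v # zs)"
    "\<forall>x\<in>set (v # zs) - {v}. E x (\<pi> x)"
    by auto
  have "\<pi> w = w"
    using \<pi>(1) 3(4) by (auto intro: permutes_not_in)
  let ?\<tau> = "\<pi> \<circ> Transposition.transpose w v"
  have "?\<tau> permutes set (w # v # zs)"
    by (intro permutes_compose permutes_swap_id permutes_subset [OF \<pi>(1)]) auto
  moreover have "?\<tau> w = last (w # v # zs)"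
    using \<pi>(2) by simp
  moreover have "E x (?\<tau> x)" if "x \<in> set (w # v # zs) - {w}" for x
  proof (cases "x = v")
    case True
    then show ?thesis
      using 3(5) \<open>\<pi> w = w\<close> by simp
  next
    case False
    then show ?thesis
      using that \<pi>(3) by (auto simp: Transposition.transpose_def)
  qed
  ultimately show ?case
    unfolding list.sel by blast
qed simp

text \<open>
  The set \<open>R\<close> of indices reachable from \<open>k\<close> is closed under successors, so the rows in \<open>R\<close> carry
  all their mass in the columns in \<open>R\<close>. This is already the whole mass of these columns, hence
  nothing enters \<open>R\<close> from outside; as the edge from \<open>i\<close> to \<open>k\<close> ends in \<open>R\<close>, it also starts there.
\<close>

lemma doubly_stochastic_simple_path_back:
  fixes A :: "real ^ 'n ^ 'n"
  assumes "doubly_stochastic A" "0 < A $ i $ k"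
  shows "\<exists>xs. xs \<noteq> [] \<and> hd xs = i \<and> last xs = k \<and> distinct xs \<and>
    successively (\<lambda>w v. 0 < A $ v $ w) xs"
proof -
  define path where "path v xs \<longleftrightarrow> xs \<noteq> [] \<and> hd xs = v \<and> last xs = k \<and> distinct xs \<and>
    successively (\<lambda>w v. 0 < A $ v $ w) xs" for v xs
  define R where "R = {v. \<exists>xs. path v xs}"
  have "path k [k]"
    by (simp add: path_def)
  then have "k \<in> R"
    unfolding R_def by blast
  have nonneg: "0 \<le> A $ v $ w" for v w
    using assms(1) by (simp add: doubly_stochastic_def nonneg_matrix_def)
  have closed: "w \<in> R" if "v \<in> R" "0 < A $ v $ w" for v w
  proof -
    obtain xs where xs: "path v xs"
      using \<open>v \<in> R\<close> unfolding R_def by blast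
    show ?thesis
    proof (cases "w \<in> set xs")
      case True
      then obtain ys zs where "xs = ys @ w # zs"
        by (meson split_list)
      then have "path w (w # zs)"
        using xs by (auto simp: path_def successively_append_iff)
      then show ?thesis
        unfolding R_def by blast
    next
      case False
      then have "path w (w # xs)"
        using xs \<open>0 < A $ v $ w\<close> by (auto simp: path_def successively_Cons)
      then show ?thesis
        unfolding R_def by blast
    qed
  qed
  have "(\<Sum>w\<in>R. A $ v $ w) = 1" if "v \<in> R" for v
  proof -
    have "(\<Sum>w\<in>R. A $ v $ w) = (\<Sum>w\<in>UNIV. A $ v $ w)"
      using closed [OF that] nonneg by (intro sum.mono_neutral_left) (auto simp: less_le)
    then show ?thesis
      using assms(1) by (simp add: doubly_stochastic_def)
  qed
  then have inner: "(\<Sum>w\<in>R. \<Sum>v\<in>R. A $ v $ w) = real (card R)"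
    by (subst sum.swap) simp
  have "(\<Sum>w\<in>R. \<Sum>v\<in>UNIV. A $ v $ w) = real (card R)"
    using assms(1) by (simp add: doubly_stochastic_def)
  moreover have "(\<Sum>v\<in>UNIV. A $ v $ w) = (\<Sum>v\<in>R. A $ v $ w) + (\<Sum>v\<in>-R. A $ v $ w)" for w
    by (subst sum.union_disjoint [symmetric]) (auto simp: Compl_partition)
  ultimately have "(\<Sum>w\<in>R. \<Sum>v\<in>-R. A $ v $ w) = 0"
    using inner by (simp add: sum.distrib)
  then have "\<forall>w\<in>R. (\<Sum>v\<in>-R. A $ v $ w) = 0"
    by (subst (asm) sum_nonneg_eq_0_iff) (auto intro: sum_nonneg nonneg)
  then have "\<forall>v\<in>-R. A $ v $ k = 0"
    using \<open>k \<in> R\<close> nonneg by (subst (asm) sum_nonneg_eq_0_iff) auto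
  then have "i \<in> R"
    using assms(2) by force
  then show ?thesis
    unfolding R_def path_def by blast
qed

text \<open>
  Permuting the columns by the given diagonal \<open>\<sigma>\<close> makes it the main diagonal; the cycle through
  the chosen entry, completed by fixed points, then is the required diagonal.
\<close>

lemma doubly_stochastic_entry_on_diagonal:
  fixes A :: "real ^ 'n ^ 'n"
  assumes ds: "doubly_stochastic A" and \<sigma>: "\<sigma> permutes UNIV" "\<And>i. 0 < A $ i $ \<sigma> i"
    and pos: "0 < A $ i $ j"
  shows "\<exists>\<tau>. \<tau> permutes UNIV \<and> \<tau> i = j \<and> (\<forall>i. 0 < A $ i $ \<tau> i)"
proof -
  define M :: "real ^ 'n ^ 'n" where "M = (\<chi> i k. A $ i $ \<sigma> k)"
  have "(\<Sum>k\<in>UNIV. A $ i $ \<sigma> k) = (\<Sum>j\<in>UNIV. A $ i $ j)" for i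
    using sum.permute [OF \<sigma>(1), of "\<lambda>j. A $ i $ j"] by (simp add: o_def)
  then have "doubly_stochastic M"
    using ds by (simp add: M_def doubly_stochastic_def nonneg_matrix_def)
  moreover obtain k where k: "\<sigma> k = j"
    using permutes_surj [OF \<sigma>(1)] by (metis surjD)
  moreover have "0 < M $ i $ k"
    using pos k by (simp add: M_def)
  ultimately obtain xs where xs: "xs \<noteq> []" "hd xs = i" "last xs = k" "distinct xs"
    "successively (\<lambda>w v. 0 < M $ v $ w) xs"
    using doubly_stochastic_simple_path_back by blast
  obtain \<pi> where \<pi>: "\<pi> permutes set xs" "\<pi> i = k" "\<forall>x\<in>set xs - {i}. 0 < M $ x $ \<pi> x"
    using path_closing_permutation [OF xs(1,4), of "\<lambda>v w. 0 < M $ v $ w"] xs by auto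
  have "0 < M $ x $ \<pi> x" for x
  proof (cases "x \<in> set xs")
    case True
    then show ?thesis
      using \<pi> \<open>0 < M $ i $ k\<close> by (cases "x = i") auto
  next
    case False
    then show ?thesis
      using permutes_not_in [OF \<pi>(1)] \<sigma>(2) by (simp add: M_def)
  qed
  moreover have "(\<sigma> \<circ> \<pi>) permutes UNIV"
    by (intro permutes_compose \<sigma>(1) permutes_subset [OF \<pi>(1)]) auto
  ultimately show ?thesis
    using \<pi>(2) k by (intro exI [of _ "\<sigma> \<circ> \<pi>"]) (simp add: M_def)
qed

section \<open>Dependence on the positive supported part only\<close>

lemma (in normalization) limit_pos_iff:
  assumes lim: "X \<longlonglongrightarrow> A" and "doubly_stochastic A"
  shows "0 < A $ i $ j \<longleftrightarrow> 0 < positive_supported_part W $ i $ j"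
proof
  assume "0 < A $ i $ j"
  obtain \<sigma> where \<sigma>: "positive_diagonal W \<sigma>"
    using support by (auto simp: has_support_def)
  then have "\<sigma> permutes UNIV"
    by (simp add: positive_diagonal_def)
  then obtain \<tau> where \<tau>: "\<tau> permutes UNIV" "\<tau> i = j" "\<forall>i. 0 < A $ i $ \<tau> i"
    using doubly_stochastic_entry_on_diagonal [OF assms(2) _ limit_pos_on_diagonal [OF lim \<sigma>]]
      \<open>0 < A $ i $ j\<close> by blast
  have "dominated A W"
    using dominated_cluster_point [of "\<lambda>t. t"] lim by simp
  then have "\<forall>i. 0 < W $ i $ \<tau> i"
    using \<tau>(3) by (simp add: dominated_def)
  with \<tau>(1) have "positive_diagonal W \<tau>"
    by (simp add: positive_diagonal_iff nonneg)
  then show "0 < positive_supported_part W $ i $ j"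
    using \<tau>(2) \<open>\<forall>i. 0 < W $ i $ \<tau> i\<close> by (auto simp: positive_supported_part_def)
next
  assume "0 < positive_supported_part W $ i $ j"
  then obtain \<sigma> where "positive_diagonal W \<sigma>" "j = \<sigma> i"
    by (auto simp: positive_supported_part_def split: if_splits)
  then show "0 < A $ i $ j"
    using limit_pos_on_diagonal [OF lim] by simp
qed

text \<open>
  Both limits have the support of the common supported part, on which the initial matrices agree.
  Applying the orthogonality to \<open>A - B\<close> for either sequence and subtracting therefore cancels the
  initial matrices and leaves the symmetrized divergence of \<open>A\<close> and \<open>B\<close>, which is thus 0.
\<close>

lemma normalization_limits_eq:
  fixes W W' :: "real ^ 'n ^ 'n"
  assumes N: "normalization W ops" and N': "normalization W' ops'"
    and lim: "normalized_seq ops W \<longlonglongrightarrow> A" "normalized_seq ops' W' \<longlonglongrightarrow> B"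
    and ds: "doubly_stochastic A" "doubly_stochastic B"
    and same: "positive_supported_part W' = positive_supported_part W"
  shows "A = B"
proof -
  interpret N: normalization W ops by fact
  interpret N': normalization W' ops' by fact
  have supp: "0 < B $ i $ j \<longleftrightarrow> 0 < A $ i $ j" for i j
    using N.limit_pos_iff [OF lim(1) ds(1)] N'.limit_pos_iff [OF lim(2) ds(2)] same by simp
  have nonneg: "0 \<le> A $ i $ j" "0 \<le> B $ i $ j" for i j
    using ds by (auto simp: doubly_stochastic_def nonneg_matrix_def)
  have zero: "A $ i $ j = 0" "B $ i $ j = 0" if "\<not> 0 < A $ i $ j" for i j
    using that supp [of i j] nonneg [of i j] by auto
  have W_eq: "W' $ i $ j = W $ i $ j" if "0 < A $ i $ j" for i j
  proof -
    have part: "positive_supported_part V $ i $ j = V $ i $ j"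
      if "0 < positive_supported_part V $ i $ j" for V :: "real ^ 'n ^ 'n"
      using that by (auto simp: positive_supported_part_def split: if_splits)
    have "0 < positive_supported_part W $ i $ j"
      using that N.limit_pos_iff [OF lim(1) ds(1)] by simp
    then have "positive_supported_part W $ i $ j = W $ i $ j"
      and "positive_supported_part W' $ i $ j = W' $ i $ j"
      using part same by simp_all
    then show ?thesis
      using same by simp
  qed
  have lines: "line_sum q (A - B) = 0" for q
    using ds [THEN doubly_stochastic_line_sum] by (simp add: line_sum_def sum_subtractf)
  have "(\<Sum>p\<in>UNIV. entry (A - B) p * (ln (entry A p) - ln (entry W p))) = 0"
    using lines zero by (intro N.limit_orthogonality [OF lim(1)]) auto
  moreover have "(\<Sum>p\<in>UNIV. entry (A - B) p * (ln (entry B p) - ln (entry W' p))) = 0"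
    using lines zero supp by (intro N'.limit_orthogonality [OF lim(2)]) auto
  moreover have eq: "entry (A - B) p * (ln (entry A p) - ln (entry W p))
      - entry (A - B) p * (ln (entry B p) - ln (entry W' p))
      = kl_term (entry A p) (entry B p) + kl_term (entry B p) (entry A p)" for p
    using zero W_eq by (cases "0 < entry A p") (auto simp: kl_term_def algebra_simps)
  ultimately have "kl_div A B + kl_div B A = 0"
    by (simp only: kl_div_def sum.distrib [symmetric] sum_subtractf flip: eq)
  moreover have "dominated A B" "dominated B A"
    using nonneg supp by (auto simp: dominated_def nonneg_matrix_def)
  ultimately have "kl_div A B \<le> 0"
    using kl_div_nonneg [of B A] by linarith
  then have "(sqrt (entry A p) - sqrt (entry B p))\<^sup>2 \<le> 0" for p
    using hellinger_le_kl_div [OF \<open>dominated A B\<close>] by (rule order_trans [rotated])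
  then have "entry A p = entry B p" for p
    by (metis eq_iff_diff_eq_0 power2_less_eq_zero_iff real_sqrt_eq_iff)
  from this [of "(i, j)" for i j] show ?thesis
    by (simp add: vec_eq_iff)
qed

theorem corollary3:
  fixes W0 :: "real ^ 'n ^ 'n" and ops :: "nat \<Rightarrow> line_kind \<times> 'n"
  assumes "nonneg_matrix W0" and "no_null_lines W0" and "has_support W0"
    and "every_line_infinitely_often ops"
  shows "\<exists>Winf. doubly_stochastic Winf \<and> normalized_seq ops W0 \<longlonglongrightarrow> Winf \<and>
    (\<forall>(W0' :: real ^ 'n ^ 'n) (ops' :: nat \<Rightarrow> line_kind \<times> 'n).
       nonneg_matrix W0' \<and> no_null_lines W0' \<and> has_support W0' \<and>
       every_line_infinitely_often ops' \<and>
       positive_supported_part W0' = positive_supported_part W0 \<longrightarrow>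
       normalized_seq ops' W0' \<longlonglongrightarrow> Winf)"
proof -
  have N: "normalization W0 ops"
    using assms by unfold_locales
  then obtain A where A: "doubly_stochastic A" "normalized_seq ops W0 \<longlonglongrightarrow> A"
    using normalization.normalized_seq_converges by blast
  have "normalized_seq ops' W0' \<longlonglongrightarrow> A"
    if "nonneg_matrix W0'" "no_null_lines W0'" "has_support W0'" "every_line_infinitely_often ops'"
      "positive_supported_part W0' = positive_supported_part W0"
    for W0' :: "real ^ 'n ^ 'n" and ops' :: "nat \<Rightarrow> line_kind \<times> 'n"
  proof -
    have N': "normalization W0' ops'"
      using that by unfold_locales
    then obtain B where B: "doubly_stochastic B" "normalized_seq ops' W0' \<longlonglongrightarrow> B"
      using normalization.normalized_seq_converges by blast
    then have "A = B"
      using normalization_limits_eq [OF N N' A(2) B(2) A(1) B(1)] that(5) by blast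
    with B show ?thesis
      by simp
  qed
  with A show ?thesis
    by blast
qed

end
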